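(* Let $G\le\mathfrak{S}_n$. The complex $(\mathcal{C}(\mathbb{F}_2)^G,D)$ is acyclic when $n$ is odd; more generally, it is acyclic whenever $G$ has at least one orbit of odd cardinality in its action on $[n]$. If $(\mathcal{C}(\mathbb{F}_2)^G,D)$ is not acyclic, then $H_0(\mathcal{C}(\mathbb{F}_2)^G,D)\cong\mathbb{F}_2$ and $H_1(\mathcal{C}(\mathbb{F}_2)^G,D)=0$.
   Context: $G\le\mathfrak{S}_n$ acts on $[n]$ and on subsets of $[n]$. Let $V$ be the $\mathbb{F}_2$-space with basis $\{e_0,e_1\}$, $\mathcal{C}(\mathbb{F}_2)=V^{\otimes n}$ with basis $e_S$ ($S\subseteq[n]$; $e_S=e_{i_1}\otimes\cdots\otimes e_{i_n}$ with $i_j=1$ iff $j\in S$), graded by $|S|$, with $G$ permuting the $e_S$. $\mathcal{C}(\mathbb{F}_2)^G$ is the subspace of $G$-invariant vectors (graded), and $D(e_S)=\sum_{j\in S}e_{S\setminus\{j\}}$ induces a boundary map of degree $-1$ on it with $D^2=0$. Acyclic means all homology groups vanish. *)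

theory Defs
  imports
    "HOL-Algebra.Sym_Groups"
    "HOL-Algebra.Group_Action"
    "HOL-Algebra.Module"
    "HOL-Algebra.AbelCoset"
    "HOL-Library.Poly_Mapping"
    "HOL-Library.Z2"
begin

section \<open>Linear algebra over the two-element field\<close>

definition F2 :: "(bit, bit) module" where
  "F2 = \<lparr>carrier = UNIV, mult = (*), one = 1, zero = 0, add = (+), smult = (*)\<rparr>"

text \<open>
  Quotient of a module by a submodule, on the cosets of \<open>N\<close>. The fields \<open>mult\<close> and \<open>one\<close>, which
  the record type inherits from rings, play no role for modules.
\<close>

definition quot_module :: "('a, 'b) module \<Rightarrow> 'b set \<Rightarrow> ('a, 'b set) module" where
  "quot_module M N =
    \<lparr>carrier = a_rcosets\<^bsub>M\<^esub> N, mult = undefined, one = undefined, zero = N, add = set_add M,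
     smult = (\<lambda>a X. \<Union>x\<in>X. N +>\<^bsub>M\<^esub> (a \<odot>\<^bsub>M\<^esub> x))\<rparr>"

definition module_iso :: "('a, 'm) ring_scheme \<Rightarrow> ('a, 'b) module \<Rightarrow> ('a, 'c) module \<Rightarrow> bool" where
  "module_iso R M N \<longleftrightarrow>
    (\<exists>f. bij_betw f (carrier M) (carrier N) \<and>
      (\<forall>x\<in>carrier M. \<forall>y\<in>carrier M. f (x \<oplus>\<^bsub>M\<^esub> y) = f x \<oplus>\<^bsub>N\<^esub> f y) \<and>
      (\<forall>a\<in>carrier R. \<forall>x\<in>carrier M. f (a \<odot>\<^bsub>M\<^esub> x) = a \<odot>\<^bsub>N\<^esub> f x))"


section \<open>The complex of invariants\<close>

text \<open>
  The basis vectors of the \<open>n\<close>-th tensor power of a space with basis \<open>e\<^sub>0, e\<^sub>1\<close> are the tensors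
  \<open>e\<^sub>S\<close> for \<open>S \<subseteq> {1..n}\<close>; the tensor power is rendered as the free \<open>F2\<close>-space on these \<open>S\<close>.
\<close>

type_synonym chain = "nat set \<Rightarrow>\<^sub>0 bit"

definition basis_vec :: "nat set \<Rightarrow> chain" where
  "basis_vec S = Poly_Mapping.single S 1"

definition chain_scale :: "bit \<Rightarrow> chain \<Rightarrow> chain" where
  "chain_scale a = Poly_Mapping.map ((*) a)"

definition tensor_space :: "nat \<Rightarrow> (bit, chain) module" where
  "tensor_space n =
    \<lparr>carrier = {c. Poly_Mapping.keys c \<subseteq> Pow {1..n}}, mult = undefined, one = undefined,
     zero = 0, add = (+), smult = chain_scale\<rparr>"

definition linear_ext :: "(nat set \<Rightarrow> chain) \<Rightarrow> chain \<Rightarrow> chain" where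
  "linear_ext f c = (\<Sum>S\<in>Poly_Mapping.keys c. chain_scale (Poly_Mapping.lookup c S) (f S))"

definition perm_act :: "(nat \<Rightarrow> nat) \<Rightarrow> chain \<Rightarrow> chain" where
  "perm_act g = linear_ext (\<lambda>S. basis_vec (g ` S))"

definition boundary :: "chain \<Rightarrow> chain" where
  "boundary = linear_ext (\<lambda>S. \<Sum>j\<in>S. basis_vec (S - {j}))"

definition invariant_chains :: "nat \<Rightarrow> (nat \<Rightarrow> nat) set \<Rightarrow> chain set" where
  "invariant_chains n G = {c \<in> carrier (tensor_space n). \<forall>g\<in>G. perm_act g c = c}"

definition invariant_chains_deg :: "nat \<Rightarrow> (nat \<Rightarrow> nat) set \<Rightarrow> nat \<Rightarrow> chain set" where
  "invariant_chains_deg n G k = {c \<in> invariant_chains n G. \<forall>S\<in>Poly_Mapping.keys c. card S = k}"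

text \<open>
  In degree \<open>0\<close> the boundary map is automatically zero, since it is an empty sum on \<open>e\<^sub>\<emptyset>\<close>; so
  \<open>cycles n G 0\<close> is the whole degree-\<open>0\<close> part.
\<close>

definition cycles :: "nat \<Rightarrow> (nat \<Rightarrow> nat) set \<Rightarrow> nat \<Rightarrow> chain set" where
  "cycles n G k = {c \<in> invariant_chains_deg n G k. boundary c = 0}"

definition boundaries :: "nat \<Rightarrow> (nat \<Rightarrow> nat) set \<Rightarrow> nat \<Rightarrow> chain set" where
  "boundaries n G k = boundary ` invariant_chains_deg n G (Suc k)"

definition homology :: "nat \<Rightarrow> (nat \<Rightarrow> nat) set \<Rightarrow> nat \<Rightarrow> (bit, chain set) module" where
  "homology n G k = quot_module (tensor_space n\<lparr>carrier := cycles n G k\<rparr>) (boundaries n G k)"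

definition homology_vanishes :: "nat \<Rightarrow> (nat \<Rightarrow> nat) set \<Rightarrow> nat \<Rightarrow> bool" where
  "homology_vanishes n G k \<longleftrightarrow> carrier (homology n G k) = {\<zero>\<^bsub>homology n G k\<^esub>}"

definition acyclic_invariants :: "nat \<Rightarrow> (nat \<Rightarrow> nat) set \<Rightarrow> bool" where
  "acyclic_invariants n G \<longleftrightarrow> (\<forall>k. homology_vanishes n G k)"

section \<open>Well-definedness\<close>

declare add_bit_eq_xor [simp del] mult_bit_eq_and [simp del] uminus_bit_def [simp del]

lemma bit_add_self [simp]: "x + x = (0 :: bit)"
  by (simp flip: mult_2)

lemma module_F2: "module F2 F2"
proof (rule moduleI)
  show "cring F2"
  proof (rule cringI)
    show "abelian_group F2"
    proof (rule abelian_groupI)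
      fix x assume "x \<in> carrier F2"
      show "\<exists>y\<in>carrier F2. y \<oplus>\<^bsub>F2\<^esub> x = \<zero>\<^bsub>F2\<^esub>"
        by (rule bexI[of _ "- x"]) (simp_all add: F2_def)
    qed (simp_all add: F2_def ac_simps)
    show "comm_monoid F2"
      by (rule comm_monoidI) (simp_all add: F2_def ac_simps)
  qed (simp add: F2_def algebra_simps)
  then show "abelian_group F2" by (simp add: cring_def ring_def)
qed (simp_all add: F2_def algebra_simps)

lemma module_quot_module:
  assumes M: "module R M" and N: "submodule N R M"
  shows "module R (quot_module M N)"
proof -
  interpret M: module R M by (rule M)
  have sub: "subgroup N (add_monoid M)" using N by (simp add: submodule_def)
  interpret N: abelian_subgroup N M
    by (rule abelian_subgroupI3[OF additive_subgroupI[OF sub] M.abelian_group_axioms])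
  have carr: "carrier (quot_module M N) = (\<lambda>x. N +>\<^bsub>M\<^esub> x) ` carrier M"
    by (auto simp: quot_module_def A_RCOSETS_def' image_iff)
  have zero: "zero (quot_module M N) = N +>\<^bsub>M\<^esub> \<zero>\<^bsub>M\<^esub>"
    using N.a_subset by (simp add: quot_module_def)
  have add: "add (quot_module M N) (N +>\<^bsub>M\<^esub> x) (N +>\<^bsub>M\<^esub> y) = N +>\<^bsub>M\<^esub> (x \<oplus>\<^bsub>M\<^esub> y)"
    if "x \<in> carrier M" "y \<in> carrier M" for x y
    using that by (simp add: quot_module_def N.a_rcos_sum)
  have smult: "smult (quot_module M N) a (N +>\<^bsub>M\<^esub> x) = N +>\<^bsub>M\<^esub> (a \<odot>\<^bsub>M\<^esub> x)"
    if a: "a \<in> carrier R" and x: "x \<in> carrier M" for a x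
  proof -
    have eq: "N +>\<^bsub>M\<^esub> (a \<odot>\<^bsub>M\<^esub> y) = N +>\<^bsub>M\<^esub> (a \<odot>\<^bsub>M\<^esub> x)" if y: "y \<in> N +>\<^bsub>M\<^esub> x" for y
    proof -
      from y obtain h where h: "h \<in> N" "y = h \<oplus>\<^bsub>M\<^esub> x" by (auto simp: a_r_coset_def')
      have hM: "h \<in> carrier M" using h N.a_subset by auto
      have "a \<odot>\<^bsub>M\<^esub> y = a \<odot>\<^bsub>M\<^esub> h \<oplus>\<^bsub>M\<^esub> a \<odot>\<^bsub>M\<^esub> x"
        using h hM a x by (simp add: M.smult_r_distr)
      moreover have "a \<odot>\<^bsub>M\<^esub> h \<in> N" using N a h by (simp add: submodule.smult_closed)
      ultimately have "a \<odot>\<^bsub>M\<^esub> y \<in> N +>\<^bsub>M\<^esub> (a \<odot>\<^bsub>M\<^esub> x)" by (auto simp: a_r_coset_def')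
      then show ?thesis using M.a_repr_independence[OF _ _ sub] a x by simp
    qed
    have "x \<in> N +>\<^bsub>M\<^esub> x" using x by (rule N.a_rcos_self)
    then have "N +>\<^bsub>M\<^esub> x \<noteq> {}" by blast
    have "smult (quot_module M N) a (N +>\<^bsub>M\<^esub> x) = (\<Union>y\<in>N +>\<^bsub>M\<^esub> x. N +>\<^bsub>M\<^esub> (a \<odot>\<^bsub>M\<^esub> y))"
      by (simp add: quot_module_def)
    also have "\<dots> = (\<Union>y\<in>N +>\<^bsub>M\<^esub> x. N +>\<^bsub>M\<^esub> (a \<odot>\<^bsub>M\<^esub> x))"
      using eq by (rule SUP_cong[OF refl])
    also have "\<dots> = N +>\<^bsub>M\<^esub> (a \<odot>\<^bsub>M\<^esub> x)"
      using \<open>N +>\<^bsub>M\<^esub> x \<noteq> {}\<close> by (simp only: UN_constant if_False)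
    finally show ?thesis .
  qed
  have "abelian_group (quot_module M N)"
  proof (rule abelian_groupI)
    fix X assume "X \<in> carrier (quot_module M N)"
    then obtain x where x: "x \<in> carrier M" "X = N +>\<^bsub>M\<^esub> x" by (auto simp: carr)
    then show "\<exists>Y\<in>carrier (quot_module M N). Y \<oplus>\<^bsub>quot_module M N\<^esub> X = \<zero>\<^bsub>quot_module M N\<^esub>"
      by (intro bexI[of _ "N +>\<^bsub>M\<^esub> (\<ominus>\<^bsub>M\<^esub> x)"]) (auto simp: carr zero add M.l_neg)
  qed (auto simp: carr zero add M.a_ac intro!: imageI)
  then show ?thesis
    by (intro moduleI M.is_cring)
       (auto simp: carr add smult M.smult_l_distr M.smult_r_distr M.smult_assoc1 intro!: imageI)
qed

lemma lookup_chain_scale [simp]: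
  "Poly_Mapping.lookup (chain_scale a c) S = a * Poly_Mapping.lookup c S"
  by (auto simp: chain_scale_def Poly_Mapping.map.rep_eq when_def)

lemma chain_add_self [simp]: "c + c = (0 :: chain)"
  by (rule poly_mapping_eqI) (simp add: lookup_add)

lemma keys_chain_scale: "Poly_Mapping.keys (chain_scale a c) \<subseteq> Poly_Mapping.keys c"
  by (auto simp: in_keys_iff)

lemma module_tensor_space: "module F2 (tensor_space n)"
proof (rule moduleI)
  show "cring F2" using module_F2 by (rule module.axioms)
  show "abelian_group (tensor_space n)"
  proof (rule abelian_groupI)
    fix c assume c: "c \<in> carrier (tensor_space n)"
    then show "\<exists>d\<in>carrier (tensor_space n). d \<oplus>\<^bsub>tensor_space n\<^esub> c = \<zero>\<^bsub>tensor_space n\<^esub>"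
      by (intro bexI[of _ c]) (simp_all add: tensor_space_def)
    fix d assume "d \<in> carrier (tensor_space n)"
    with c show "c \<oplus>\<^bsub>tensor_space n\<^esub> d \<in> carrier (tensor_space n)"
      using keys_add[of c d] by (auto simp: tensor_space_def)
  qed (simp_all add: tensor_space_def ac_simps)
  fix a c assume "c \<in> carrier (tensor_space n)"
  then show "a \<odot>\<^bsub>tensor_space n\<^esub> c \<in> carrier (tensor_space n)"
    using keys_chain_scale[of a c] by (auto simp: tensor_space_def)
qed (simp_all add: tensor_space_def F2_def poly_mapping_eq_iff fun_eq_iff lookup_add algebra_simps)

lemma linear_ext_superset:
  assumes "finite A" "Poly_Mapping.keys c \<subseteq> A"
  shows "linear_ext f c = (\<Sum>S\<in>A. chain_scale (Poly_Mapping.lookup c S) (f S))"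
  unfolding linear_ext_def using assms
  by (intro sum.mono_neutral_left) (auto simp: in_keys_iff intro!: poly_mapping_eqI)

lemma linear_ext_add: "linear_ext f (c + d) = linear_ext f c + linear_ext f d"
proof -
  let ?A = "Poly_Mapping.keys c \<union> Poly_Mapping.keys d"
  have "chain_scale (Poly_Mapping.lookup (c + d) S) (f S) =
      chain_scale (Poly_Mapping.lookup c S) (f S) + chain_scale (Poly_Mapping.lookup d S) (f S)"
    for S by (rule poly_mapping_eqI) (simp add: lookup_add algebra_simps)
  then show ?thesis
    by (simp add: linear_ext_superset[of ?A] keys_add sum.distrib)
qed

lemma linear_ext_scale: "linear_ext f (chain_scale a c) = chain_scale a (linear_ext f c)"
  by (rule poly_mapping_eqI)
     (simp add: linear_ext_superset[OF finite_keys keys_chain_scale] linear_ext_def[of f c]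
       lookup_sum sum_distrib_left mult.assoc)

lemma linear_ext_0 [simp]: "linear_ext f 0 = 0"
  by (simp add: linear_ext_def)

lemma linear_ext_sum: "linear_ext f (sum g A) = (\<Sum>x\<in>A. linear_ext f (g x))"
  by (induction A rule: infinite_finite_induct) (auto simp: linear_ext_add)

lemma linear_ext_basis_vec: "linear_ext f (basis_vec S) = f S"
  by (rule poly_mapping_eqI) (simp add: linear_ext_def basis_vec_def)

lemma linear_ext_linear_ext:
  "linear_ext f (linear_ext g c) = linear_ext (\<lambda>S. linear_ext f (g S)) c"
  by (simp add: linear_ext_def[of g] linear_ext_sum linear_ext_scale linear_ext_def[of "\<lambda>S. linear_ext f (g S)"])

lemma boundary_basis_vec: "boundary (basis_vec S) = (\<Sum>j\<in>S. basis_vec (S - {j}))"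
  by (simp add: boundary_def linear_ext_basis_vec)

lemma perm_act_basis_vec: "perm_act g (basis_vec S) = basis_vec (g ` S)"
  by (simp add: perm_act_def linear_ext_basis_vec)

lemma sum_offdiagonal_eq_0:
  fixes f :: "'a \<Rightarrow> 'a \<Rightarrow> chain"
  assumes "finite S" and sym: "\<And>i j. f i j = f j i"
  shows "(\<Sum>j\<in>S. \<Sum>i\<in>S - {j}. f j i) = 0"
  using \<open>finite S\<close>
proof induction
  case (insert a S)
  have "(\<Sum>i\<in>insert a S - {j}. f j i) = f j a + (\<Sum>i\<in>S - {j}. f j i)" if "j \<in> S" for j
  proof -
    have "insert a S - {j} = insert a (S - {j})" using insert that by auto
    then show ?thesis using insert by simp
  qed
  moreover have "insert a S - {a} = S" using insert by auto
  ultimately have "(\<Sum>j\<in>insert a S. \<Sum>i\<in>insert a S - {j}. f j i)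
      = (\<Sum>i\<in>S. f a i) + (\<Sum>j\<in>S. f j a)"
    using insert by (simp add: sum.distrib)
  then show ?case by (simp add: sym[of a])
qed simp

lemma boundary_boundary: "boundary (boundary c) = 0"
proof -
  have "boundary (\<Sum>j\<in>S. basis_vec (S - {j})) = 0" for S
  proof (cases "finite S")
    case True
    have "boundary (\<Sum>j\<in>S. basis_vec (S - {j})) = (\<Sum>j\<in>S. \<Sum>i\<in>S - {j}. basis_vec (S - {j} - {i}))"
      by (simp add: boundary_def linear_ext_sum linear_ext_basis_vec)
    also have "\<dots> = 0"
      by (rule sum_offdiagonal_eq_0[OF True]) (auto intro: arg_cong[of _ _ basis_vec])
    finally show ?thesis .
  qed (simp add: boundary_def)
  then have "linear_ext (\<lambda>S. boundary (\<Sum>j\<in>S. basis_vec (S - {j}))) c = 0"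
    by (simp add: linear_ext_def poly_mapping_eq_iff fun_eq_iff lookup_sum)
  then show ?thesis by (simp add: boundary_def linear_ext_linear_ext)
qed

lemma perm_act_boundary:
  assumes "inj g"
  shows "perm_act g (boundary c) = boundary (perm_act g c)"
proof -
  have "g ` (S - {j}) = g ` S - {g j}" for S j
    using assms by (auto dest: injD)
  then have "perm_act g (\<Sum>j\<in>S. basis_vec (S - {j})) = boundary (basis_vec (g ` S))" for S
    using assms
    by (simp add: perm_act_def boundary_def linear_ext_sum linear_ext_basis_vec
        sum.reindex[OF inj_on_subset[OF assms]])
  then show ?thesis
    by (simp add: perm_act_def boundary_def linear_ext_linear_ext)
qed

lemma keys_boundary:
  assumes "T \<in> Poly_Mapping.keys (boundary c)"
  obtains S j where "S \<in> Poly_Mapping.keys c" "finite S" "j \<in> S" "T = S - {j}"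
proof -
  have "(\<Sum>S\<in>Poly_Mapping.keys c. Poly_Mapping.lookup c S *
      (\<Sum>j\<in>S. Poly_Mapping.lookup (basis_vec (S - {j})) T)) \<noteq> 0"
    using assms by (simp add: boundary_def linear_ext_def in_keys_iff lookup_sum del: bit_not_zero_iff)
  then obtain S where S: "S \<in> Poly_Mapping.keys c"
    and nz: "(\<Sum>j\<in>S. Poly_Mapping.lookup (basis_vec (S - {j})) T) \<noteq> 0"
    by (metis (no_types, lifting) mult_zero_right sum.neutral)
  then obtain j where "j \<in> S" "Poly_Mapping.lookup (basis_vec (S - {j})) T \<noteq> 0"
    by (metis (no_types, lifting) sum.neutral)
  moreover have "finite S" using nz by (metis sum.infinite)
  ultimately show ?thesis using that S
    by (auto simp: basis_vec_def lookup_single when_def split: if_splits)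
qed

lemma boundary_invariant_chains_deg:
  assumes G: "subgroup G (sym_group n)" and c: "c \<in> invariant_chains_deg n G (Suc k)"
  shows "boundary c \<in> invariant_chains_deg n G k"
proof -
  have "inj g" if "g \<in> G" for g
    using subgroup.subset[OF G] that permutes_inj by (auto simp: sym_group_def)
  then have "\<forall>g\<in>G. perm_act g (boundary c) = boundary c"
    using c by (auto simp: perm_act_boundary invariant_chains_deg_def invariant_chains_def)
  moreover have "T \<subseteq> {1..n} \<and> card T = k" if T: "T \<in> Poly_Mapping.keys (boundary c)" for T
  proof -
    from T obtain S j where "S \<in> Poly_Mapping.keys c" "finite S" "j \<in> S" "T = S - {j}"
      by (rule keys_boundary)
    with c show ?thesis
      by (auto simp: invariant_chains_deg_def invariant_chains_def tensor_space_def)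
  qed
  ultimately show ?thesis
    by (auto simp: invariant_chains_deg_def invariant_chains_def tensor_space_def)
qed

lemma submoduleI_chains:
  assumes "H \<subseteq> carrier (tensor_space n)" "0 \<in> H"
    and "\<And>c d. c \<in> H \<Longrightarrow> d \<in> H \<Longrightarrow> c + d \<in> H"
  shows "submodule H F2 (tensor_space n)"
proof -
  interpret module F2 "tensor_space n" by (rule module_tensor_space)
  have "\<ominus>\<^bsub>tensor_space n\<^esub> c = c" if "c \<in> carrier (tensor_space n)" for c
    using that by (intro M.minus_equality) (auto simp: tensor_space_def)
  moreover have "chain_scale a c = (if a = 0 then 0 else c)" for a c
    by (auto intro!: poly_mapping_eqI)
  ultimately show ?thesis using assms
    by (intro submoduleI) (auto simp: tensor_space_def)
qed

lemma submodule_invariant_chains_deg: "submodule (invariant_chains_deg n G k) F2 (tensor_space n)"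
proof (rule submoduleI_chains)
  fix c d assume "c \<in> invariant_chains_deg n G k" "d \<in> invariant_chains_deg n G k"
  then show "c + d \<in> invariant_chains_deg n G k"
    using keys_add[of c d]
    by (auto simp: invariant_chains_deg_def invariant_chains_def tensor_space_def perm_act_def linear_ext_add)
qed (auto simp: invariant_chains_deg_def invariant_chains_def tensor_space_def perm_act_def)

lemma add_invariant_chains_deg:
  assumes "c \<in> invariant_chains_deg n G k" "d \<in> invariant_chains_deg n G k"
  shows "c + d \<in> invariant_chains_deg n G k"
  using module.submoduleE(5)[OF module_tensor_space submodule_invariant_chains_deg assms]
  by (simp add: tensor_space_def)

lemma zero_invariant_chains_deg: "0 \<in> invariant_chains_deg n G k"
  by (auto simp: invariant_chains_deg_def invariant_chains_def tensor_space_def perm_act_def)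

lemma submodule_cycles: "submodule (cycles n G k) F2 (tensor_space n)"
  by (rule submoduleI_chains)
     (auto simp: cycles_def boundary_def linear_ext_add add_invariant_chains_deg
        zero_invariant_chains_deg, auto simp: invariant_chains_deg_def invariant_chains_def)

lemma module_homology:
  assumes G: "subgroup G (sym_group n)"
  shows "module F2 (homology n G k)"
proof -
  let ?Z = "tensor_space n\<lparr>carrier := cycles n G k\<rparr>"
  have Z: "module F2 ?Z"
    by (rule submodule.submodule_is_module[OF submodule_cycles module_tensor_space])
  have BZ: "boundaries n G k \<subseteq> cycles n G k"
    using boundary_invariant_chains_deg[OF G] by (auto simp: boundaries_def cycles_def boundary_boundary)
  have B: "submodule (boundaries n G k) F2 (tensor_space n)"
  proof (rule submoduleI_chains)
    show "boundaries n G k \<subseteq> carrier (tensor_space n)"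
      using BZ by (auto simp: cycles_def invariant_chains_deg_def invariant_chains_def)
    show "0 \<in> boundaries n G k"
      unfolding boundaries_def boundary_def
      by (rule image_eqI[where x = 0]) (auto simp: zero_invariant_chains_deg)
    fix c d assume "c \<in> boundaries n G k" "d \<in> boundaries n G k"
    then show "c + d \<in> boundaries n G k"
      unfolding boundaries_def boundary_def
      by (auto simp flip: linear_ext_add intro: add_invariant_chains_deg)
  qed
  have "submodule (boundaries n G k) F2 ?Z"
  proof (rule module.module_incl_imp_submodule[OF Z])
    show "module F2 (?Z\<lparr>carrier := boundaries n G k\<rparr>)"
      using submodule.submodule_is_module[OF B module_tensor_space] by simp
  qed (use BZ in simp)
  then show ?thesis unfolding homology_def by (rule module_quot_module[OF Z])
qed

end

theory Submission
  imports Defs "HOL-Library.Ramsey"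
begin

text \<open>
  Adjoining a vertex \<open>i\<close> is a cone operator \<open>K\<^sub>i\<close> with \<open>D K\<^sub>i + K\<^sub>i D = 1\<close>. A single \<open>K\<^sub>i\<close> need
  not commute with \<open>G\<close>, but \<open>\<Sum>i\<in>A. K\<^sub>i\<close> does when \<open>A\<close> is \<open>G\<close>-stable, and it is a homotopy from
  \<open>card A\<close> times the identity to \<open>0\<close>; so a stable set of odd size makes the complex acyclic.

  For stable \<open>A\<close> the sum \<open>\<sigma>\<^sub>k(A)\<close> of all \<open>e\<^sub>P\<close> with \<open>P \<subseteq> A\<close> and \<open>card P = k\<close> is invariant, and
  \<open>D \<sigma>\<^bsub>k+1\<^esub>(A) = (card A - k) \<sigma>\<^sub>k(A)\<close>. Every invariant chain of degree \<open>1\<close> is some \<open>\<sigma>\<^sub>1(A)\<close>. It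
  is a cycle only if \<open>card A\<close> is even, and then it is the boundary of \<open>\<sigma>\<^sub>2(A)\<close>. Degree \<open>0\<close> is
  spanned by \<open>\<sigma>\<^sub>0(A) = e\<^sub>\<emptyset>\<close>, which is a boundary only if some stable set has odd size.
\<close>

section \<open>Chains over the two-element field\<close>

lemma chain_eq_iff_keys: "c = d \<longleftrightarrow> Poly_Mapping.keys c = Poly_Mapping.keys d"
  for c d :: "'a \<Rightarrow>\<^sub>0 bit"
proof
  assume keys: "Poly_Mapping.keys c = Poly_Mapping.keys d"
  show "c = d"
  proof (rule poly_mapping_eqI)
    fix x
    have "x \<in> Poly_Mapping.keys c \<longleftrightarrow> x \<in> Poly_Mapping.keys d" using keys by simp
    then show "Poly_Mapping.lookup c x = Poly_Mapping.lookup d x"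
      by (cases "Poly_Mapping.lookup d x") (simp_all add: in_keys_iff)
  qed
qed simp

lemma sum_const_chain: "(\<Sum>x\<in>A. c) = (if odd (card A) then c else 0)" for c :: chain
  by (induction A rule: infinite_finite_induct) auto

lemma lookup_basis_vec: "Poly_Mapping.lookup (basis_vec S) T = (if S = T then 1 else 0)"
  by (simp add: basis_vec_def lookup_single when_def)

lemma keys_basis_vec [simp]: "Poly_Mapping.keys (basis_vec S) = {S}"
  by (simp add: basis_vec_def)

lemma keys_sum_basis_vec:
  assumes "finite F"
  shows "Poly_Mapping.keys (\<Sum>S\<in>F. basis_vec S) = F"
  using assms by (auto simp: in_keys_iff lookup_sum lookup_basis_vec split: if_splits)

lemma linear_ext_eq_sum: "linear_ext f c = (\<Sum>S\<in>Poly_Mapping.keys c. f S)"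
proof -
  have "chain_scale (Poly_Mapping.lookup c S) (f S) = f S" if "S \<in> Poly_Mapping.keys c" for S
    using that by (intro poly_mapping_eqI) (simp add: in_keys_iff)
  then show ?thesis by (simp add: linear_ext_def)
qed

lemma chain_eq_sum_basis_vec: "(\<Sum>S\<in>Poly_Mapping.keys c. basis_vec S) = c"
  by (simp add: chain_eq_iff_keys keys_sum_basis_vec)

lemma boundary_sum: "boundary (sum f A) = (\<Sum>x\<in>A. boundary (f x))"
  by (simp add: boundary_def linear_ext_sum)

lemma perm_act_sum: "perm_act g (sum f A) = (\<Sum>x\<in>A. perm_act g (f x))"
  by (simp add: perm_act_def linear_ext_sum)

lemma boundary_0 [simp]: "boundary 0 = 0"
  by (simp add: boundary_def)

lemma perm_act_0 [simp]: "perm_act g 0 = 0"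
  by (simp add: perm_act_def)

lemma keys_perm_act:
  assumes "inj g"
  shows "Poly_Mapping.keys (perm_act g c) = (`) g ` Poly_Mapping.keys c"
proof -
  have "inj_on ((`) g) (Poly_Mapping.keys c)"
    using assms by (auto intro: inj_onI simp: inj_image_eq_iff)
  then have "perm_act g c = (\<Sum>T\<in>(`) g ` Poly_Mapping.keys c. basis_vec T)"
    by (simp add: perm_act_def linear_ext_eq_sum sum.reindex)
  then show ?thesis by (simp add: keys_sum_basis_vec)
qed

lemma perm_act_fixed_iff:
  assumes "inj g"
  shows "perm_act g c = c \<longleftrightarrow> (`) g ` Poly_Mapping.keys c = Poly_Mapping.keys c"
  using assms by (simp add: chain_eq_iff_keys keys_perm_act)

section \<open>Cone operators\<close>

definition cone :: "nat \<Rightarrow> chain \<Rightarrow> chain" where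
  "cone i = linear_ext (\<lambda>S. if i \<in> S then 0 else basis_vec (insert i S))"

definition sum_cone :: "nat set \<Rightarrow> chain \<Rightarrow> chain" where
  "sum_cone A c = (\<Sum>i\<in>A. cone i c)"

lemma cone_basis_vec: "cone i (basis_vec S) = (if i \<in> S then 0 else basis_vec (insert i S))"
  by (simp add: cone_def linear_ext_basis_vec)

lemma cone_sum: "cone i (sum f A) = (\<Sum>x\<in>A. cone i (f x))"
  by (simp add: cone_def linear_ext_sum)

lemma cone_0 [simp]: "cone i 0 = 0"
  by (simp add: cone_def)

lemma boundary_cone_basis_vec:
  assumes S: "finite S"
  shows "boundary (cone i (basis_vec S)) + cone i (boundary (basis_vec S)) = basis_vec S"
proof (cases "i \<in> S")
  case True
  have "cone i (boundary (basis_vec S)) = (\<Sum>j\<in>S. cone i (basis_vec (S - {j})))"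
    by (simp add: boundary_basis_vec cone_sum)
  also have "\<dots> = (\<Sum>j\<in>S. if j = i then basis_vec S else 0)"
    using True by (intro sum.cong) (auto simp: cone_basis_vec insert_absorb)
  also have "\<dots> = basis_vec S" using True S by simp
  finally show ?thesis using True by (simp add: cone_basis_vec)
next
  case False
  have face: "insert i S - {j} = insert i (S - {j})" if "j \<in> S" for j
    using False that by auto
  have "boundary (cone i (basis_vec S)) = (\<Sum>j\<in>insert i S. basis_vec (insert i S - {j}))"
    using False by (simp add: cone_basis_vec boundary_basis_vec)
  also have "\<dots> = basis_vec S + (\<Sum>j\<in>S. basis_vec (insert i (S - {j})))"
    using False S by (simp add: face)
  also have "(\<Sum>j\<in>S. basis_vec (insert i (S - {j}))) = cone i (boundary (basis_vec S))"
    using False by (simp add: boundary_basis_vec cone_sum cone_basis_vec)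
  finally show ?thesis by (simp add: add.assoc)
qed

lemma boundary_cone:
  assumes "\<And>S. S \<in> Poly_Mapping.keys c \<Longrightarrow> finite S"
  shows "boundary (cone i c) + cone i (boundary c) = c"
proof -
  have "boundary (cone i c) + cone i (boundary c) = (\<Sum>S\<in>Poly_Mapping.keys c.
      boundary (cone i (basis_vec S)) + cone i (boundary (basis_vec S)))"
    by (subst (1 2) chain_eq_sum_basis_vec[of c, symmetric])
       (simp only: boundary_sum cone_sum sum.distrib)
  also have "\<dots> = c"
    using assms by (simp add: boundary_cone_basis_vec chain_eq_sum_basis_vec)
  finally show ?thesis .
qed

lemma boundary_sum_cone:
  assumes "\<And>S. S \<in> Poly_Mapping.keys c \<Longrightarrow> finite S"
  shows "boundary (sum_cone A c) + sum_cone A (boundary c) = (if odd (card A) then c else 0)"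
proof -
  have "boundary (sum_cone A c) + sum_cone A (boundary c)
      = (\<Sum>i\<in>A. boundary (cone i c) + cone i (boundary c))"
    by (simp add: sum_cone_def boundary_sum sum.distrib)
  also have "\<dots> = (\<Sum>i\<in>A. c)"
    using boundary_cone[OF assms] by simp
  finally show ?thesis by (simp add: sum_const_chain)
qed

lemma perm_act_cone:
  assumes "inj g"
  shows "perm_act g (cone i c) = cone (g i) (perm_act g c)"
proof -
  have "perm_act g (cone i (basis_vec S)) = cone (g i) (basis_vec (g ` S))" for S
    using assms by (simp add: cone_basis_vec perm_act_basis_vec inj_image_mem_iff)
  then show ?thesis
    by (simp add: perm_act_def cone_def linear_ext_linear_ext linear_ext_basis_vec)
qed

lemma perm_act_sum_cone:
  assumes g: "inj g" "g ` A = A"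
  shows "perm_act g (sum_cone A c) = sum_cone A (perm_act g c)"
proof -
  have "perm_act g (sum_cone A c) = (\<Sum>i\<in>A. cone (g i) (perm_act g c))"
    using g(1) by (simp add: sum_cone_def perm_act_sum perm_act_cone)
  also have "\<dots> = (\<Sum>i\<in>g ` A. cone i (perm_act g c))"
    using inj_on_subset[OF g(1)] by (simp add: sum.reindex)
  finally show ?thesis using g(2) by (simp add: sum_cone_def)
qed

lemma keys_cone_subset:
  "Poly_Mapping.keys (cone i c) \<subseteq> insert i ` {S \<in> Poly_Mapping.keys c. i \<notin> S}"
proof -
  have "Poly_Mapping.keys (cone i c)
      \<subseteq> (\<Union>S\<in>Poly_Mapping.keys c. Poly_Mapping.keys (if i \<in> S then 0 else basis_vec (insert i S)))"
    unfolding cone_def linear_ext_eq_sum by (rule keys_sum)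
  then show ?thesis by (auto split: if_splits)
qed

lemma keys_sum_cone_subset:
  "Poly_Mapping.keys (sum_cone A c) \<subseteq> (\<Union>i\<in>A. insert i ` {S \<in> Poly_Mapping.keys c. i \<notin> S})"
  unfolding sum_cone_def
  by (rule order_trans[OF keys_sum UN_mono[OF order_refl keys_cone_subset]])

section \<open>Sums over subsets of fixed size\<close>

definition nsets_chain :: "nat set \<Rightarrow> nat \<Rightarrow> chain" where
  "nsets_chain A k = (\<Sum>P\<in>[A]\<^bsup>k\<^esup>. basis_vec P)"

lemma keys_nsets_chain:
  assumes "finite A"
  shows "Poly_Mapping.keys (nsets_chain A k) = [A]\<^bsup>k\<^esup>"
  using assms by (simp add: nsets_chain_def keys_sum_basis_vec finite_imp_finite_nsets)

lemma nsets_chain_0 [simp]: "nsets_chain A 0 = basis_vec {}"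
  by (simp add: nsets_chain_def)

text \<open>
  Each \<open>Q \<in> [A]\<^bsup>k\<^esup>\<close> arises by deleting a vertex from exactly \<open>card A - k\<close> sets in \<open>[A]\<^bsup>k+1\<^esup>\<close>; the
  parity is written as that of \<open>card A + k\<close> to avoid truncated subtraction.
\<close>

lemma boundary_nsets_chain:
  assumes A: "finite A"
  shows "boundary (nsets_chain A (Suc k)) = (if odd (card A + k) then nsets_chain A k else 0)"
proof -
  have fin: "finite ([A]\<^bsup>m\<^esup>)" for m
    using A by (rule finite_imp_finite_nsets)
  have "boundary (nsets_chain A (Suc k)) = (\<Sum>P\<in>[A]\<^bsup>Suc k\<^esup>. \<Sum>j\<in>P. basis_vec (P - {j}))"
    by (simp add: nsets_chain_def boundary_sum boundary_basis_vec)
  also have "\<dots> = (\<Sum>(P, j)\<in>Sigma ([A]\<^bsup>Suc k\<^esup>) (\<lambda>P. P). basis_vec (P - {j}))"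
    by (rule sum.Sigma[OF fin]) (simp add: nsets_def)
  also have "\<dots> = (\<Sum>(Q, j)\<in>Sigma ([A]\<^bsup>k\<^esup>) (\<lambda>Q. A - Q). basis_vec Q)"
    by (rule sum.reindex_bij_witness[of _ "\<lambda>(Q, j). (insert j Q, j)" "\<lambda>(P, j). (P - {j}, j)"])
       (auto simp: nsets_def insert_absorb)
  also have "\<dots> = (\<Sum>Q\<in>[A]\<^bsup>k\<^esup>. \<Sum>j\<in>A - Q. basis_vec Q)"
    by (rule sum.Sigma[OF fin, symmetric]) (simp add: A)
  also have "\<dots> = (\<Sum>Q\<in>[A]\<^bsup>k\<^esup>. if odd (card A + k) then basis_vec Q else 0)"
    using card_mono[OF A]
    by (intro sum.cong) (auto simp: sum_const_chain nsets_def card_Diff_subset dest: leD)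
  finally show ?thesis by (simp add: nsets_chain_def)
qed

section \<open>Quotient modules\<close>

lemma carrier_quot_module_self:
  assumes "abelian_group M"
  shows "carrier (quot_module M (carrier M)) = {carrier M}"
proof -
  interpret abelian_group M by (rule assms)
  have "carrier M +>\<^bsub>M\<^esub> x = carrier M" if "x \<in> carrier M" for x
    using that add.subgroup_self by (intro a_coset_join2) simp_all
  then show ?thesis by (auto simp: quot_module_def A_RCOSETS_def')
qed

lemma module_iso_quot_module_zero:
  assumes "module R M"
  shows "module_iso R (quot_module M {\<zero>\<^bsub>M\<^esub>}) M"
proof -
  interpret module R M by (rule assms)
  let ?Q = "quot_module M {\<zero>\<^bsub>M\<^esub>}"
  have coset: "{\<zero>\<^bsub>M\<^esub>} +>\<^bsub>M\<^esub> x = {x}" if "x \<in> carrier M" for x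
    using that by (simp add: a_r_coset_def')
  have carr: "carrier ?Q = (\<lambda>x. {x}) ` carrier M"
    by (auto simp: quot_module_def A_RCOSETS_def' coset)
  have add: "{x} \<oplus>\<^bsub>?Q\<^esub> {y} = {x \<oplus>\<^bsub>M\<^esub> y}" for x y
    by (simp add: quot_module_def set_add_def')
  have smult: "a \<odot>\<^bsub>?Q\<^esub> {x} = {a \<odot>\<^bsub>M\<^esub> x}" if "a \<in> carrier R" "x \<in> carrier M" for a x
    using that by (simp add: quot_module_def coset)
  have "bij_betw the_elem (carrier ?Q) (carrier M)"
    by (auto simp: carr bij_betw_def inj_on_def image_image)
  then show ?thesis
    unfolding module_iso_def by (intro exI[of _ the_elem]) (auto simp: carr add smult)
qed

lemma module_iso_trans:
  assumes "module_iso R L M" "module_iso R M N"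
  shows "module_iso R L N"
proof -
  obtain f where f: "bij_betw f (carrier L) (carrier M)"
    "\<And>x y. x \<in> carrier L \<Longrightarrow> y \<in> carrier L \<Longrightarrow> f (x \<oplus>\<^bsub>L\<^esub> y) = f x \<oplus>\<^bsub>M\<^esub> f y"
    "\<And>a x. a \<in> carrier R \<Longrightarrow> x \<in> carrier L \<Longrightarrow> f (a \<odot>\<^bsub>L\<^esub> x) = a \<odot>\<^bsub>M\<^esub> f x"
    using assms(1) unfolding module_iso_def by auto
  obtain g where g: "bij_betw g (carrier M) (carrier N)"
    "\<And>x y. x \<in> carrier M \<Longrightarrow> y \<in> carrier M \<Longrightarrow> g (x \<oplus>\<^bsub>M\<^esub> y) = g x \<oplus>\<^bsub>N\<^esub> g y"
    "\<And>a x. a \<in> carrier R \<Longrightarrow> x \<in> carrier M \<Longrightarrow> g (a \<odot>\<^bsub>M\<^esub> x) = a \<odot>\<^bsub>N\<^esub> g x"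
    using assms(2) unfolding module_iso_def by auto
  have "f x \<in> carrier M" if "x \<in> carrier L" for x
    using bij_betwE[OF f(1)] that by blast
  then show ?thesis
    unfolding module_iso_def
    by (intro exI[of _ "g \<circ> f"]) (simp add: bij_betw_trans[OF f(1) g(1)] f(2,3) g(2,3))
qed

section \<open>Homology of the invariants\<close>

definition stable_set :: "nat \<Rightarrow> (nat \<Rightarrow> nat) set \<Rightarrow> nat set \<Rightarrow> bool" where
  "stable_set n G A \<longleftrightarrow> A \<subseteq> {1..n} \<and> (\<forall>g\<in>G. g ` A = A)"

lemma finite_stable_set: "stable_set n G A \<Longrightarrow> finite A"
  unfolding stable_set_def using finite_subset by blast

lemma invariant_chains_deg_iff:
  "c \<in> invariant_chains_deg n G k \<longleftrightarrow>
    Poly_Mapping.keys c \<subseteq> [{1..n}]\<^bsup>k\<^esup> \<and> (\<forall>g\<in>G. perm_act g c = c)"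
  unfolding invariant_chains_deg_def invariant_chains_def tensor_space_def nsets_def
  by (auto dest: finite_subset[OF _ finite_atLeastAtMost])

lemma module_cycles: "module F2 (tensor_space n\<lparr>carrier := cycles n G k\<rparr>)"
  by (rule submodule.submodule_is_module[OF submodule_cycles module_tensor_space])

lemma cycles_0: "cycles n G 0 = {0, basis_vec {}}"
proof -
  have "{0, basis_vec {}} \<subseteq> cycles n G 0"
    by (simp add: cycles_def invariant_chains_deg_iff perm_act_basis_vec boundary_basis_vec)
  moreover have "c \<in> {0, basis_vec {}}" if "c \<in> cycles n G 0" for c
  proof -
    have "Poly_Mapping.keys c \<subseteq> {{}}"
      using that by (simp add: cycles_def invariant_chains_deg_iff)
    then show ?thesis
      by (simp add: subset_singleton_iff chain_eq_iff_keys[of c "basis_vec {}"])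
  qed
  ultimately show ?thesis by blast
qed

lemma module_iso_cycles_0: "module_iso F2 (tensor_space n\<lparr>carrier := cycles n G 0\<rparr>) F2"
proof -
  let ?f = "\<lambda>c :: chain. Poly_Mapping.lookup c {}"
  have "bij_betw ?f {0, basis_vec {}} UNIV"
    unfolding bij_betw_def using bit.exhaust by (auto simp: lookup_basis_vec)
  then show ?thesis
    unfolding module_iso_def
    by (intro exI[of _ ?f]) (simp add: cycles_0 F2_def tensor_space_def lookup_add)
qed

context
  fixes n :: nat and G :: "(nat \<Rightarrow> nat) set"
  assumes subgroup_G: "subgroup G (sym_group n)"
begin

lemma permutes_if_mem: "g \<in> G \<Longrightarrow> g permutes {1..n}"
  using subgroup.subset[OF subgroup_G] by (auto simp: sym_group_carrier)

lemma inj_if_mem: "g \<in> G \<Longrightarrow> inj g"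
  using permutes_if_mem by (rule permutes_inj)

lemma stable_set_atLeastAtMost: "stable_set n G {1..n}"
  using permutes_image[OF permutes_if_mem] by (simp add: stable_set_def)

lemma stable_set_orbit:
  assumes "B \<in> orbits (sym_group n\<lparr>carrier := G\<rparr>) {1..n} (\<lambda>g x. g x)"
  shows "stable_set n G B"
proof -
  from assms obtain x where x: "x \<in> {1..n}" and B: "B = (\<lambda>h. h x) ` G"
    by (auto simp: orbits_def orbit_def)
  have "g ` B = B" if g: "g \<in> G" for g
  proof -
    have "g ` B = (\<lambda>h. h x) ` (g <#\<^bsub>sym_group n\<^esub> G)"
      by (auto simp: B l_coset_def sym_group_mult image_iff)
    also have "g <#\<^bsub>sym_group n\<^esub> G = G"
      using g subgroup_G subgroup.subset[OF subgroup_G]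
      by (intro group.coset_join3[OF sym_group_is_group]) auto
    finally show ?thesis by (simp add: B)
  qed
  moreover have "B \<subseteq> {1..n}"
    using x permutes_if_mem unfolding B by (blast dest: permutes_in_image)
  ultimately show ?thesis by (simp add: stable_set_def)
qed

lemma stable_set_support:
  assumes "c \<in> invariant_chains_deg n G k"
  shows "stable_set n G (\<Union>(Poly_Mapping.keys c))"
proof -
  have "g ` \<Union>(Poly_Mapping.keys c) = \<Union>(Poly_Mapping.keys c)" if "g \<in> G" for g
    using assms that perm_act_fixed_iff[OF inj_if_mem[OF that], of c]
    by (simp add: invariant_chains_deg_iff image_Union)
  moreover have "\<Union>(Poly_Mapping.keys c) \<subseteq> {1..n}"
    using assms by (auto simp: invariant_chains_deg_iff nsets_def)
  ultimately show ?thesis by (simp add: stable_set_def)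
qed

lemma nsets_chain_invariant:
  assumes A: "stable_set n G A"
  shows "nsets_chain A k \<in> invariant_chains_deg n G k"
proof -
  have "perm_act g (nsets_chain A k) = nsets_chain A k" if "g \<in> G" for g
  proof -
    have "bij_betw g A A"
      using A that inj_on_subset[OF inj_if_mem[OF that]] by (auto simp: stable_set_def bij_betw_def)
    then have "(`) g ` [A]\<^bsup>k\<^esup> = [A]\<^bsup>k\<^esup>"
      by (intro bij_betw_imp_surj_on bij_betw_nsets)
    then show ?thesis
      by (simp add: perm_act_fixed_iff[OF inj_if_mem[OF that]] keys_nsets_chain finite_stable_set[OF A])
  qed
  moreover have "[A]\<^bsup>k\<^esup> \<subseteq> [{1..n}]\<^bsup>k\<^esup>"
    using A by (intro nsets_mono) (simp add: stable_set_def)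
  ultimately show ?thesis
    by (simp add: invariant_chains_deg_iff keys_nsets_chain finite_stable_set[OF A])
qed

lemma sum_cone_invariant:
  assumes A: "stable_set n G A" and c: "c \<in> invariant_chains_deg n G k"
  shows "sum_cone A c \<in> invariant_chains_deg n G (Suc k)"
proof -
  have "perm_act g (sum_cone A c) = sum_cone A c" if "g \<in> G" for g
    using A c that by (simp add: perm_act_sum_cone inj_if_mem stable_set_def invariant_chains_deg_iff)
  moreover have "insert i S \<in> [{1..n}]\<^bsup>Suc k\<^esup>" if "i \<in> A" "i \<notin> S" "S \<in> Poly_Mapping.keys c" for i S
    using A c that by (auto simp: invariant_chains_deg_iff nsets_def stable_set_def)
  ultimately show ?thesis
    using keys_sum_cone_subset[of A c] by (auto simp: invariant_chains_deg_iff)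
qed

lemma invariant_chain_deg_1E:
  assumes c: "c \<in> invariant_chains_deg n G 1"
  obtains A where "stable_set n G A" "c = nsets_chain A 1"
proof
  let ?A = "\<Union>(Poly_Mapping.keys c)"
  show stable: "stable_set n G ?A"
    using c by (rule stable_set_support)
  have "Poly_Mapping.keys c \<subseteq> range (\<lambda>a. {a})"
    using c by (auto simp: invariant_chains_deg_iff nsets_one)
  then have "Poly_Mapping.keys c = [?A]\<^bsup>1\<^esup>"
    by (fastforce simp: nsets_one)
  then show "c = nsets_chain ?A 1"
    using stable by (simp add: chain_eq_iff_keys keys_nsets_chain[OF finite_stable_set])
qed

lemma boundaries_subset_cycles: "boundaries n G k \<subseteq> cycles n G k"
  using boundary_invariant_chains_deg[OF subgroup_G]
  by (auto simp: boundaries_def cycles_def boundary_boundary)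

lemma homology_vanishesI:
  assumes "cycles n G k \<subseteq> boundaries n G k"
  shows "homology_vanishes n G k"
proof -
  let ?Z = "tensor_space n\<lparr>carrier := cycles n G k\<rparr>"
  have "boundaries n G k = carrier ?Z"
    using assms boundaries_subset_cycles by auto
  moreover have "abelian_group ?Z"
    using module_cycles by (rule module.axioms)
  ultimately have "carrier (homology n G k) = {boundaries n G k}"
    using carrier_quot_module_self[of ?Z] by (simp add: homology_def)
  moreover have "\<zero>\<^bsub>homology n G k\<^esub> = boundaries n G k"
    by (simp add: homology_def quot_module_def)
  ultimately show ?thesis by (simp add: homology_vanishes_def)
qed

lemma acyclic_if_odd_stable_set:
  assumes A: "stable_set n G A" "odd (card A)"
  shows "acyclic_invariants n G"
  unfolding acyclic_invariants_def
proof (intro allI homology_vanishesI subsetI)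
  fix k c assume "c \<in> cycles n G k"
  then have c: "c \<in> invariant_chains_deg n G k" and cycle: "boundary c = 0"
    by (auto simp: cycles_def)
  have "finite S" if "S \<in> Poly_Mapping.keys c" for S
    using c that by (auto simp: invariant_chains_deg_iff nsets_def)
  then have "boundary (sum_cone A c) + sum_cone A (boundary c) = c"
    using A(2) by (simp add: boundary_sum_cone)
  then have "c = boundary (sum_cone A c)"
    by (simp add: cycle sum_cone_def)
  then show "c \<in> boundaries n G k"
    unfolding boundaries_def using sum_cone_invariant[OF A(1) c] by (rule image_eqI)
qed

lemma homology_1_vanishes: "homology_vanishes n G 1"
proof (intro homology_vanishesI subsetI)
  fix c assume "c \<in> cycles n G 1"
  then have c: "c \<in> invariant_chains_deg n G 1" and cycle: "boundary c = 0"
    by (auto simp: cycles_def)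
  from c obtain A where A: "stable_set n G A" and c_eq: "c = nsets_chain A 1"
    by (rule invariant_chain_deg_1E)
  note fin = finite_stable_set[OF A]
  have "basis_vec {} \<noteq> 0" by (simp add: chain_eq_iff_keys)
  then have "even (card A)"
    using cycle boundary_nsets_chain[OF fin, of 0] by (auto simp: c_eq split: if_splits)
  then have "c = boundary (nsets_chain A (Suc 1))"
    using boundary_nsets_chain[OF fin, of 1] by (simp add: c_eq)
  then show "c \<in> boundaries n G 1"
    unfolding boundaries_def using nsets_chain_invariant[OF A] by (rule image_eqI)
qed

lemma boundaries_0_if_not_acyclic:
  assumes "\<not> acyclic_invariants n G"
  shows "boundaries n G 0 = {0}"
proof -
  have "boundary c = 0" if "c \<in> invariant_chains_deg n G 1" for c
  proof -
    from that obtain A where A: "stable_set n G A" and c: "c = nsets_chain A 1"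
      by (rule invariant_chain_deg_1E)
    then have "even (card A)" using acyclic_if_odd_stable_set assms by blast
    then show ?thesis
      using boundary_nsets_chain[OF finite_stable_set[OF A], of 0] by (simp add: c)
  qed
  then show ?thesis
    using zero_invariant_chains_deg[of n G 1] by (force simp: boundaries_def)
qed

lemma homology_0_iso_if_not_acyclic:
  assumes "\<not> acyclic_invariants n G"
  shows "module_iso F2 (homology n G 0) F2"
proof -
  let ?Z = "tensor_space n\<lparr>carrier := cycles n G 0\<rparr>"
  have "\<zero>\<^bsub>?Z\<^esub> = 0"
    by (simp add: tensor_space_def)
  then have "homology n G 0 = quot_module ?Z {\<zero>\<^bsub>?Z\<^esub>}"
    using boundaries_0_if_not_acyclic[OF assms] by (simp add: homology_def)
  then have "module_iso F2 (homology n G 0) ?Z"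
    using module_iso_quot_module_zero[OF module_cycles] by simp
  then show ?thesis using module_iso_cycles_0 by (rule module_iso_trans)
qed

end

theorem theorem2p5:
  fixes n :: nat and G :: "(nat \<Rightarrow> nat) set"
  assumes "subgroup G (sym_group n)"
  shows "(odd n \<longrightarrow> acyclic_invariants n G)
    \<and> ((\<exists>B \<in> orbits (sym_group n\<lparr>carrier := G\<rparr>) {1..n} (\<lambda>g x. g x). odd (card B))
        \<longrightarrow> acyclic_invariants n G)
    \<and> (\<not> acyclic_invariants n G
        \<longrightarrow> module_iso F2 (homology n G 0) F2 \<and> homology_vanishes n G 1)"
proof (intro conjI impI)
  assume "odd n"
  then show "acyclic_invariants n G"
    using acyclic_if_odd_stable_set[OF assms stable_set_atLeastAtMost[OF assms]] by simp
next
  assume "\<exists>B \<in> orbits (sym_group n\<lparr>carrier := G\<rparr>) {1..n} (\<lambda>g x. g x). odd (card B)"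
  then show "acyclic_invariants n G"
    using acyclic_if_odd_stable_set[OF assms stable_set_orbit[OF assms]] by blast
next
  assume "\<not> acyclic_invariants n G"
  then show "module_iso F2 (homology n G 0) F2"
    by (rule homology_0_iso_if_not_acyclic[OF assms])
  show "homology_vanishes n G 1" by (rule homology_1_vanishes[OF assms])
qed

end
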